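(* Let the graph be connected, let $z\in\mathbb{R}^n$ with $z_{\mathcal M^\perp}\neq 0$, and for $\alpha\in\mathbb{R}$ let $z(\alpha)=z-\alpha e$ and $h(\alpha)=\sigma(z(\alpha))$, where $\sigma(x)=\max\{x,0\}$ is ReLU applied entrywise. Put $x:=\tilde D^{-1/2}z$ and $\max x:=\max_{1\le i\le n}x_i$, and let $d_1,\dots,d_n$ be the diagonal entries of $\tilde D$. Then $$\min_{\alpha} s(h(\alpha))=\sqrt{\frac{\sum_{i:\,x_i=\max x}d_i}{\sum_{j=1}^n d_j}}\qquad\text{and}\qquad \max_\alpha s(h(\alpha))=1.$$ In particular, $s(h(\alpha))$ is monotone increasing (in the non-strict sense) as $\alpha$ decreases whenever $\alpha<\|\tilde D^{1/2}u_n\|\max x$, where $u_n=(1,\dots,1)^\top\in\mathbb{R}^n$, and the range of $\alpha\mapsto s(h(\alpha))$ over $\alpha\in\mathbb{R}$ is $[\min_\alpha s(h(\alpha)),1]$.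
   Context: Let $G=(V,E)$ be an undirected connected graph with $n$ nodes, adjacency matrix $A\in\{0,1\}^{n\times n}$ and diagonal degree matrix $D$, $D_{ii}=\sum_jA_{ij}$. Put $\tilde A=A+I$, $\tilde D=D+I$ (the augmented degree matrix), and $\mathbf G=\tilde D^{-1/2}\tilde A\tilde D^{-1/2}$. The eigenspace $\mathcal M$ of $\mathbf G$ for its largest eigenvalue $1$ is one-dimensional, spanned by the unit vector $e=\tilde D^{1/2}u_n/\|\tilde D^{1/2}u_n\|$ with $u_n$ the all-ones vector. For $z\in\mathbb{R}^n$ write $z_{\mathcal M}=\langle z,e\rangle e$ and $z_{\mathcal M^\perp}=z-z_{\mathcal M}$. The normalized smoothness of $z$ is $s(z):=\|z_{\mathcal M}\|/\|z\|$ (Euclidean norms), with the convention $s(0)=1$. *)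

theory Defs
  imports "HOL-Analysis.Analysis" "Graph_Theory.Graph_Theory"
begin

text \<open>
  An undirected graph on the node set given by a finite type is a symmetric
  \<^typ>\<open>'n pair_pre_digraph\<close> (locale \<^const>\<open>pair_pseudo_graph\<close>, which does not exclude
  self-loops) whose vertex set is all of the type. Connectedness is
  \<^const>\<open>Digraph_Component.connected\<close>; the unqualified name may also denote the
  topological notion.
\<close>

definition adj_mat :: "'n::finite pair_pre_digraph \<Rightarrow> real ^ 'n ^ 'n" where
  "adj_mat G = (\<chi> i j. if (i, j) \<in> parcs G then 1 else 0)"

definition deg_mat :: "'n::finite pair_pre_digraph \<Rightarrow> real ^ 'n ^ 'n" where
  "deg_mat G = (\<chi> i j. if i = j then \<Sum>k\<in>UNIV. adj_mat G $ i $ k else 0)"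

definition aug_adj :: "'n::finite pair_pre_digraph \<Rightarrow> real ^ 'n ^ 'n" where
  "aug_adj G = adj_mat G + mat 1"

definition aug_deg :: "'n::finite pair_pre_digraph \<Rightarrow> real ^ 'n ^ 'n" where
  "aug_deg G = deg_mat G + mat 1"

text \<open>Real power of a diagonal matrix with positive diagonal; off-diagonal entries are ignored.\<close>
definition diag_powr :: "real ^ 'n ^ 'n \<Rightarrow> real \<Rightarrow> real ^ 'n ^ 'n" where
  "diag_powr M p = (\<chi> i j. if i = j then (M $ i $ i) powr p else 0)"

definition norm_adj :: "'n::finite pair_pre_digraph \<Rightarrow> real ^ 'n ^ 'n" where
  "norm_adj G = diag_powr (aug_deg G) (- 1 / 2) ** aug_adj G ** diag_powr (aug_deg G) (- 1 / 2)"

text \<open>The vector \<open>D\<^sup>1\<^sup>/\<^sup>2 u\<close> for the augmented degree matrix \<open>D\<close> and the all-ones vector \<open>u\<close>.\<close>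
definition top_dir :: "'n::finite pair_pre_digraph \<Rightarrow> real ^ 'n" where
  "top_dir G = diag_powr (aug_deg G) (1 / 2) *v (\<chi> i. 1)"

definition top_vec :: "'n::finite pair_pre_digraph \<Rightarrow> real ^ 'n" where
  "top_vec G = (1 / norm (top_dir G)) *\<^sub>R top_dir G"

text \<open>
  \<open>top_comp G z\<close> and \<open>perp_comp G z\<close> are the components of \<open>z\<close> in the eigenspace of
  \<open>norm_adj G\<close> for its largest eigenvalue 1 and in the orthogonal complement of that eigenspace,
  see \<open>norm_adj_eigenspace\<close> and \<open>norm_adj_eigenvalue_le\<close> below.
\<close>
definition top_comp :: "'n::finite pair_pre_digraph \<Rightarrow> real ^ 'n \<Rightarrow> real ^ 'n" where
  "top_comp G z = (z \<bullet> top_vec G) *\<^sub>R top_vec G"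

definition perp_comp :: "'n::finite pair_pre_digraph \<Rightarrow> real ^ 'n \<Rightarrow> real ^ 'n" where
  "perp_comp G z = z - top_comp G z"

definition smoothness :: "'n::finite pair_pre_digraph \<Rightarrow> real ^ 'n \<Rightarrow> real" where
  "smoothness G z = (if z = 0 then 1 else norm (top_comp G z) / norm z)"

definition relu :: "real ^ 'n \<Rightarrow> real ^ 'n" where
  "relu z = (\<chi> i. max (z $ i) 0)"

lemma aug_adj_nonneg: "0 \<le> aug_adj G $ i $ j"
  by (simp add: aug_adj_def adj_mat_def mat_def)

lemma aug_deg_diag: "aug_deg G $ i $ i = (\<Sum>j\<in>UNIV. aug_adj G $ i $ j)"
  by (simp add: aug_deg_def deg_mat_def aug_adj_def mat_def sum.distrib)

lemma aug_deg_pos: "0 < aug_deg G $ i $ i"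
  by (simp add: aug_deg_def deg_mat_def adj_mat_def mat_def add_nonneg_pos sum_nonneg)

lemma diag_powr_nth: "(diag_powr M p *v v) $ i = (M $ i $ i) powr p * v $ i"
  by (simp add: diag_powr_def matrix_vector_mult_def if_distribR if_distrib[of "\<lambda>u. u * _"] cong: if_cong)

lemma top_dir_nth: "top_dir G $ i = sqrt (aug_deg G $ i $ i)"
  using aug_deg_pos[of G i] by (simp add: top_dir_def diag_powr_nth powr_half_sqrt)

lemma norm_top_vec: "norm (top_vec G) = 1"
proof -
  have "top_dir G \<noteq> 0"
    using aug_deg_pos[of G undefined] top_dir_nth[of G undefined]
    by (metis less_irrefl real_sqrt_eq_zero_cancel_iff zero_index)
  then show ?thesis by (simp add: top_vec_def)
qed

lemma norm_adj_eigen_iff: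
  fixes G :: "'n::finite pair_pre_digraph" and v :: "real ^ 'n"
  defines "x \<equiv> diag_powr (aug_deg G) (- 1 / 2) *v v"
  shows "norm_adj G *v v = c *\<^sub>R v \<longleftrightarrow>
    (\<forall>i. (\<Sum>j\<in>UNIV. aug_adj G $ i $ j * x $ j) = c * (aug_deg G $ i $ i * x $ i))"
proof -
  have "(norm_adj G *v v) $ i = (aug_deg G $ i $ i) powr (- 1 / 2) * (\<Sum>j\<in>UNIV. aug_adj G $ i $ j * x $ j)" for i
  proof -
    have "norm_adj G *v v = diag_powr (aug_deg G) (- 1 / 2) *v (aug_adj G *v x)"
      by (simp add: norm_adj_def x_def matrix_vector_mul_assoc matrix_mul_assoc)
    then show ?thesis
      by (simp add: diag_powr_nth) (simp add: matrix_vector_mult_def)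
  qed
  moreover have "v $ i = (aug_deg G $ i $ i) powr (- 1 / 2) * (aug_deg G $ i $ i * x $ i)" for i
  proof -
    let ?d = "aug_deg G $ i $ i"
    have "?d powr (- 1 / 2) * ?d powr (- 1 / 2) * ?d = ?d powr (- 1 / 2 + - 1 / 2 + 1)"
      using aug_deg_pos[of G i] by (simp only: powr_add powr_one)
    also have "\<dots> = 1" using aug_deg_pos[of G i] by simp
    finally have "?d powr (- 1 / 2) * ?d powr (- 1 / 2) * ?d * v $ i = v $ i" by simp
    then show ?thesis by (simp only: x_def diag_powr_nth ac_simps)
  qed
  moreover have "(aug_deg G $ i $ i) powr (- 1 / 2) \<noteq> 0" for i
    using aug_deg_pos[of G i] by simp
  ultimately have "(norm_adj G *v v) $ i = c * v $ i \<longleftrightarrow>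
      (\<Sum>j\<in>UNIV. aug_adj G $ i $ j * x $ j) = c * (aug_deg G $ i $ i * x $ i)" for i
    by (simp only: mult.left_commute[of c] mult_cancel_left) simp
  then show ?thesis by (simp add: vec_eq_iff)
qed

lemma norm_adj_eigenvalue_le:
  fixes v :: "real ^ 'n::finite"
  assumes "norm_adj G *v v = c *\<^sub>R v" and "v \<noteq> 0"
  shows "\<bar>c\<bar> \<le> 1"
proof -
  define x where "x = diag_powr (aug_deg G) (- 1 / 2) *v v"
  have ev: "(\<Sum>j\<in>UNIV. aug_adj G $ i $ j * x $ j) = c * (aug_deg G $ i $ i * x $ i)" for i
    using assms(1) unfolding norm_adj_eigen_iff x_def by blast
  obtain k where k: "v $ k \<noteq> 0" using assms(2) by (auto simp: vec_eq_iff)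
  define i where "i = (ARG_MAX (\<lambda>i. \<bar>x $ i\<bar>) i. True)"
  have imax: "\<bar>x $ j\<bar> \<le> \<bar>x $ i\<bar>" for j
  proof -
    have "Max (range (\<lambda>i. \<bar>x $ i\<bar>)) \<in> range (\<lambda>i. \<bar>x $ i\<bar>)" by (intro Max_in) auto
    then obtain m where "Max (range (\<lambda>i. \<bar>x $ i\<bar>)) = \<bar>x $ m\<bar>" by (rule imageE)
    then have "is_arg_max (\<lambda>i. \<bar>x $ i\<bar>) (\<lambda>_. True) m"
      unfolding is_arg_max_linorder by (metis Max_ge finite finite_imageI rangeI)
    then have "is_arg_max (\<lambda>i. \<bar>x $ i\<bar>) (\<lambda>_. True) i"
      unfolding i_def arg_max_def by (rule someI)
    then show ?thesis by (simp add: is_arg_max_linorder)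
  qed
  have "x $ k \<noteq> 0" using k aug_deg_pos[of G k] by (simp add: x_def diag_powr_nth)
  then have xi: "0 < \<bar>x $ i\<bar>" using imax[of k] by linarith
  have "\<bar>c\<bar> * (aug_deg G $ i $ i * \<bar>x $ i\<bar>) = \<bar>\<Sum>j\<in>UNIV. aug_adj G $ i $ j * x $ j\<bar>"
    using ev[of i] aug_deg_pos[of G i] by (simp add: abs_mult)
  also have "\<dots> \<le> (\<Sum>j\<in>UNIV. aug_adj G $ i $ j * \<bar>x $ i\<bar>)"
    by (rule order_trans[OF sum_abs])
      (auto intro!: sum_mono mult_left_mono simp: abs_mult aug_adj_nonneg imax)
  also have "\<dots> = aug_deg G $ i $ i * \<bar>x $ i\<bar>"
    by (simp add: aug_deg_diag sum_distrib_right)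
  finally show ?thesis
    using xi aug_deg_pos[of G i] by (simp add: mult_le_cancel_right1)
qed

lemma norm_adj_eigenspace:
  fixes G :: "'n::finite pair_pre_digraph"
  assumes "pair_pseudo_graph G" and "pverts G = UNIV"
    and con: "Digraph_Component.connected (with_proj G)"
  shows "{v. norm_adj G *v v = v} = span {top_vec G}"
proof (intro set_eqI iffI)
  fix v :: "real ^ 'n"
  define x where "x = diag_powr (aug_deg G) (- 1 / 2) *v v"
  have v: "v $ i = sqrt (aug_deg G $ i $ i) * x $ i" for i
    using aug_deg_pos[of G i]
    by (simp add: x_def diag_powr_nth powr_minus powr_half_sqrt)
  have nz: "norm (top_dir G) \<noteq> 0"
    using norm_top_vec[of G] by (auto simp: top_vec_def)
  {
    assume "v \<in> {v. norm_adj G *v v = v}"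
    then have "norm_adj G *v v = 1 *\<^sub>R v" by simp
    then have ev: "(\<Sum>j\<in>UNIV. aug_adj G $ i $ j * x $ j) = aug_deg G $ i $ i * x $ i" for i
      unfolding norm_adj_eigen_iff x_def by simp
    have "Max (range (($) x)) \<in> range (($) x)" by (intro Max_in) auto
    then obtain i where i: "Max (range (($) x)) = x $ i" by (rule imageE)
    have imax: "x $ j \<le> x $ i" for j using i by (metis Max_ge finite finite_imageI rangeI)
    have step: "x $ k = x $ i" if "(j, k) \<in> parcs G" "x $ j = x $ i" for j k
    proof -
      have "(\<Sum>l\<in>UNIV. aug_adj G $ j $ l * (x $ i - x $ l)) = 0"
        using ev[of j] that(2)
        by (simp add: right_diff_distrib sum_subtractf aug_deg_diag sum_distrib_right)
      then have "aug_adj G $ j $ k * (x $ i - x $ k) = 0"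
        by (subst (asm) sum_nonneg_eq_0_iff) (auto simp: aug_adj_nonneg imax)
      moreover have "aug_adj G $ j $ k > 0"
        using that(1) by (simp add: aug_adj_def adj_mat_def mat_def)
      ultimately show ?thesis by simp
    qed
    interpret pair_pseudo_graph G by fact
    have reach: "i \<rightarrow>\<^sup>*\<^bsub>with_proj G\<^esub> k" for k
      using con assms(2) sym_arcs reachable_mk_symmetric_eq
      by (auto simp: connected_def strongly_connected_def)
    have const: "x $ k = x $ i" for k
      using reach[of k] by (induct rule: reachable_induct) (auto intro: step)
    have "v $ k = ((x $ i * norm (top_dir G)) *\<^sub>R top_vec G) $ k" for k
      using v[of k] const[of k] nz by (simp add: top_vec_def top_dir_nth)
    then have "v = (x $ i * norm (top_dir G)) *\<^sub>R top_vec G"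
      by (simp add: vec_eq_iff)
    then show "v \<in> span {top_vec G}" by (auto simp: span_singleton)
  }
  {
    assume "v \<in> span {top_vec G}"
    then obtain a where "v = a *\<^sub>R top_vec G" by (auto simp: span_singleton)
    then have "x $ i = a / norm (top_dir G)" for i
      using v[of i] aug_deg_pos[of G i] nz by (simp add: top_vec_def top_dir_nth field_simps)
    then have "norm_adj G *v v = 1 *\<^sub>R v"
      unfolding norm_adj_eigen_iff x_def[symmetric]
      by (simp add: aug_deg_diag sum_distrib_right sum_divide_distrib)
    then show "v \<in> {v. norm_adj G *v v = v}" by simp
  }
qed

end

(*
  Put t = alpha / ||D^(1/2) u||. Entrywise, h(alpha) is sqrt d_i * w_i with
  w_i = max (x_i - t) 0, so the smoothness of a nonzero h(alpha) is
  (sum d w) / sqrt (sum d * sum d w^2). Let w and w' belong to t and to some t' < t,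
  respectively. Since w / w' increases with w', Chebyshev's sum inequality gives
  (sum d w) (sum d w'^2) <= (sum d w w') (sum d w'); bounding sum d w w' by Cauchy-Schwarz
  yields the monotonicity. Just below max x only the maximal entries are active, which gives
  the minimum; as t tends to minus infinity the smoothness tends to 1, and h = 0 attains 1.
*)
theory Submission
  imports Defs
begin

text \<open>The cosine of the angle between the vectors with entries
  \<open>sqrt (d i) * max (x i - t) 0\<close> and \<open>sqrt (d i)\<close>. From
  \<open>t = Max (range x)\<close> on it is 0/0, hence 0, whereas the smoothness of the zero vector
  is 1; this is why t stays below the maximum.\<close>

definition relu_ratio :: "('a::finite \<Rightarrow> real) \<Rightarrow> ('a \<Rightarrow> real) \<Rightarrow> real \<Rightarrow> real" where
  "relu_ratio d x t = (\<Sum>i\<in>UNIV. d i * max (x i - t) 0)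
     / (sqrt (\<Sum>i\<in>UNIV. d i) * sqrt (\<Sum>i\<in>UNIV. d i * (max (x i - t) 0)\<^sup>2))"

section \<open>Monotonicity of the quotient in the threshold\<close>

lemma sum_relu_sq_pos:
  fixes d x :: "'a::finite \<Rightarrow> real"
  assumes d: "\<And>i. 0 < d i" and t: "t < (MAX k. x k)"
  shows "0 < (\<Sum>i\<in>UNIV. d i * (max (x i - t) 0)\<^sup>2)"
proof -
  have "Max (range x) \<in> range x" by (intro Max_in) auto
  then obtain k where "Max (range x) = x k" by (rule imageE)
  then have "0 < d k * (max (x k - t) 0)\<^sup>2" using d t by simp
  then show ?thesis by (intro sum_pos2[of _ k]) (auto simp: d less_imp_le)
qed

text \<open>Division-free form of: the quotient of the truncations at t and at s grows with the
  truncation at s. Hence both factors have the same sign.\<close>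

lemma relu_cross_nonneg:
  fixes a b s t :: real
  assumes "s \<le> t"
  shows "0 \<le> (max (a - s) 0 - max (b - s) 0)
    * (max (a - t) 0 * max (b - s) 0 - max (b - t) 0 * max (a - s) 0)"
proof -
  have ord: "max (b - t) 0 * max (a - s) 0 \<le> max (a - t) 0 * max (b - s) 0" if "b \<le> a" for a b
  proof (cases "t < b")
    case True
    \<comment> \<open>The right side exceeds the left by \<open>(a - b) * (t - s)\<close>.\<close>
    have "(b - t) * (a - s) \<le> (a - t) * (b - s)"
      using mult_right_mono[OF that, of "t - s"] assms by (simp add: algebra_simps)
    then show ?thesis using True that assms by (simp add: max_def)
  qed simp
  show ?thesis
  proof (cases "b \<le> a")
    case True
    then show ?thesis using ord[OF True] by (intro mult_nonneg_nonneg) auto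
  next
    case False
    then show ?thesis using ord[of a b] by (intro mult_nonpos_nonpos) auto
  qed
qed

lemma sum_relu_Chebyshev:
  fixes d x :: "'a::finite \<Rightarrow> real"
  assumes d: "\<And>i. 0 < d i" and st: "s \<le> t"
  shows "(\<Sum>i\<in>UNIV. d i * max (x i - t) 0) * (\<Sum>i\<in>UNIV. d i * (max (x i - s) 0)\<^sup>2)
    \<le> (\<Sum>i\<in>UNIV. d i * (max (x i - t) 0 * max (x i - s) 0)) * (\<Sum>i\<in>UNIV. d i * max (x i - s) 0)"
    (is "?A * ?B' \<le> ?C * ?A'")
proof -
  let ?w = "\<lambda>i. max (x i - t) 0" and ?v = "\<lambda>i. max (x i - s) 0"
  \<comment> \<open>Summing the sign condition over all ordered pairs gives twice the difference of
    the two sides of the claim.\<close>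
  have "0 \<le> (\<Sum>i\<in>UNIV. \<Sum>j\<in>UNIV. d i * d j * ((?v i - ?v j) * (?w i * ?v j - ?w j * ?v i)))"
    by (intro sum_nonneg mult_nonneg_nonneg relu_cross_nonneg st) (auto simp: d less_imp_le)
  also have "\<dots> = (\<Sum>i\<in>UNIV. \<Sum>j\<in>UNIV.
      d i * (?w i * ?v i) * (d j * ?v j) + d i * ?v i * (d j * (?w j * ?v j))
      - d i * ?w i * (d j * (?v j)\<^sup>2) - d i * (?v i)\<^sup>2 * (d j * ?w j))"
    by (intro sum.cong refl) (simp add: algebra_simps power2_eq_square)
  also have "\<dots> = ?C * ?A' + ?A' * ?C - ?A * ?B' - ?B' * ?A"
    by (simp only: sum_product sum.distrib sum_subtractf)
  finally show ?thesis by (simp add: mult.commute)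
qed

lemma relu_ratio_antimono:
  fixes d x :: "'a::finite \<Rightarrow> real"
  assumes d: "\<And>i. 0 < d i" and st: "s \<le> t" and t: "t < (MAX k. x k)"
  shows "relu_ratio d x t \<le> relu_ratio d x s"
proof -
  let ?w = "\<lambda>i. max (x i - t) 0" and ?v = "\<lambda>i. max (x i - s) 0"
  let ?A = "\<Sum>i\<in>UNIV. d i * ?w i" and ?A' = "\<Sum>i\<in>UNIV. d i * ?v i"
  let ?B = "\<Sum>i\<in>UNIV. d i * (?w i)\<^sup>2" and ?B' = "\<Sum>i\<in>UNIV. d i * (?v i)\<^sup>2"
  let ?C = "\<Sum>i\<in>UNIV. d i * (?w i * ?v i)"
  have B: "0 < ?B" "0 < ?B'" using st t by (auto intro!: sum_relu_sq_pos d)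
  have nonneg: "0 \<le> ?A" "0 \<le> ?A'" by (auto intro!: sum_nonneg mult_nonneg_nonneg simp: d less_imp_le)
  have D: "0 < sqrt (\<Sum>i\<in>UNIV. d i)" using d by (simp add: sum_pos)
  \<comment> \<open>Each weight is split into two square roots, one for either factor of
    Cauchy-Schwarz.\<close>
  have "?C = (\<Sum>i\<in>UNIV. (sqrt (d i) * ?w i) * (sqrt (d i) * ?v i))"
    by (intro sum.cong refl) (simp add: d less_imp_le algebra_simps flip: real_sqrt_mult)
  also have "\<dots> \<le> (\<Sum>i\<in>UNIV. \<bar>sqrt (d i) * ?w i\<bar> * \<bar>sqrt (d i) * ?v i\<bar>)"
    unfolding abs_mult[symmetric] by (intro sum_mono abs_ge_self)
  also have "\<dots> \<le> L2_set (\<lambda>i. sqrt (d i) * ?w i) UNIV * L2_set (\<lambda>i. sqrt (d i) * ?v i) UNIV"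
    by (rule L2_set_mult_ineq)
  also have "\<dots> = sqrt ?B * sqrt ?B'"
    by (simp add: L2_set_def power_mult_distrib d less_imp_le)
  finally have C: "?C \<le> sqrt ?B * sqrt ?B'" by simp
  \<comment> \<open>The second \<open>sqrt ?B'\<close> completes \<open>?B'\<close> for Chebyshev;
    Cauchy-Schwarz then produces the same factor on the right, and it cancels.\<close>
  have "?A * sqrt ?B' * sqrt ?B' = ?A * ?B'" using B by (simp add: mult.assoc)
  also have "\<dots> \<le> ?C * ?A'" by (rule sum_relu_Chebyshev[OF d st])
  also have "\<dots> \<le> sqrt ?B * sqrt ?B' * ?A'" by (rule mult_right_mono[OF C nonneg(2)])
  finally have "?A * sqrt ?B' * sqrt ?B' \<le> ?A' * sqrt ?B * sqrt ?B'" by (simp add: ac_simps)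
  then have "?A * sqrt ?B' \<le> ?A' * sqrt ?B" using B by simp
  then have "?A / sqrt ?B \<le> ?A' / sqrt ?B'" using B by (simp add: field_simps)
  then have "?A / sqrt ?B / sqrt (\<Sum>i\<in>UNIV. d i) \<le> ?A' / sqrt ?B' / sqrt (\<Sum>i\<in>UNIV. d i)"
    using D by (intro divide_right_mono) auto
  then show ?thesis by (simp add: relu_ratio_def mult.commute)
qed

section \<open>Extreme values and continuity of the quotient\<close>

text \<open>Between the second largest value of x and the largest, all active entries share the
  value \<open>?M - t\<close>, which cancels. The quotient is thus constant there, and the minimum
  is attained, not only approached.\<close>

lemma relu_ratio_near_Max:
  fixes d x :: "'a::finite \<Rightarrow> real"
  assumes d: "\<And>i. 0 < d i"
  obtains b where "b < (MAX k. x k)"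
    and "\<And>t. \<lbrakk>b \<le> t; t < (MAX k. x k)\<rbrakk> \<Longrightarrow>
      relu_ratio d x t = sqrt ((\<Sum>i\<in>{i. x i = (MAX k. x k)}. d i) / (\<Sum>i\<in>UNIV. d i))"
proof
  let ?M = "MAX k. x k"
  \<comment> \<open>Its maximum is the witness b; \<open>?M - 1\<close> keeps the set nonempty when
    x is constant.\<close>
  let ?S = "insert (?M - 1) (range x - {?M})"
  let ?I = "{i. x i = ?M}"
  have le: "x i \<le> ?M" for i by simp
  have "\<forall>s\<in>?S. s < ?M" using le by (auto simp: less_le)
  then show "Max ?S < ?M" by (subst Max_less_iff) auto
  fix t assume t: "Max ?S \<le> t" "t < ?M"
  have w: "max (x i - t) 0 = (if x i = ?M then ?M - t else 0)" for i
  proof (cases "x i = ?M")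
    case False
    then have "x i \<le> Max ?S" by (intro Max_ge) auto
    then show ?thesis using t False by simp
  qed (use t in simp)
  have sums: "(\<Sum>i\<in>UNIV. d i * max (x i - t) 0) = sum d ?I * (?M - t)"
    "(\<Sum>i\<in>UNIV. d i * (max (x i - t) 0)\<^sup>2) = sum d ?I * (?M - t)\<^sup>2"
    using t unfolding sum_distrib_right by (auto intro!: sum.mono_neutral_cong_right simp: w split: if_splits)
  have "?M \<in> range x" by (intro Max_in) auto
  then obtain k where "?M = x k" by (rule imageE)
  then have I: "0 < sum d ?I" by (intro sum_pos2[of _ k]) (auto simp: d less_imp_le)
  have "relu_ratio d x t = sum d ?I * (?M - t) / (sqrt (sum d UNIV) * (sqrt (sum d ?I) * (?M - t)))"
    using t by (simp add: relu_ratio_def sums real_sqrt_mult)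
  also have "\<dots> = sum d ?I / sqrt (sum d ?I) / sqrt (sum d UNIV)" using t by simp
  also have "\<dots> = sqrt (sum d ?I / sum d UNIV)" using I by (simp add: real_div_sqrt real_sqrt_divide)
  finally show "relu_ratio d x t = sqrt (sum d ?I / sum d UNIV)" .
qed

text \<open>Once every entry is active, the quotient is at least \<open>(?a - t) / (?M - t)\<close>,
  which tends to 1 as t decreases.\<close>

lemma relu_ratio_ge_far:
  fixes d x :: "'a::finite \<Rightarrow> real"
  assumes d: "\<And>i. 0 < d i" and y: "0 \<le> y" "y < 1"
  shows "\<exists>t<b. y \<le> relu_ratio d x t"
proof -
  let ?M = "MAX k. x k" and ?a = "MIN k. x k"
  have le: "?a \<le> x i" "x i \<le> ?M" for i by simp_all
  \<comment> \<open>The fraction solves \<open>?a - t = y * (?M - t)\<close> for t; subtracting 1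
    makes the other two bounds strict.\<close>
  define t where "t = min (min b ?a) ((?a - y * ?M) / (1 - y)) - 1"
  have t: "t < b" "t < ?a" "t * (1 - y) \<le> ?a - y * ?M"
  proof -
    have "t + 1 \<le> min b ?a" by (simp only: t_def diff_add_cancel min.cobounded1)
    then show "t < b" "t < ?a" using min.cobounded1[of b ?a] min.cobounded2[of b ?a] by linarith+
    have "t \<le> (?a - y * ?M) / (1 - y)" by (auto simp: t_def)
    then show "t * (1 - y) \<le> ?a - y * ?M" using y by (simp add: pos_le_divide_eq)
  qed
  have lt: "t < x i" "t < ?M" for i using le[of i] t(2) by linarith+
  let ?D = "sum d UNIV"
  have D: "0 < ?D" using d by (simp add: sum_pos)
  have num: "?D * (?a - t) \<le> (\<Sum>i\<in>UNIV. d i * max (x i - t) 0)"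
    unfolding sum_distrib_right using le d
    by (intro sum_mono mult_left_mono) (auto simp: less_imp_le intro: max.coboundedI1)
  have "(\<Sum>i\<in>UNIV. d i * (max (x i - t) 0)\<^sup>2) \<le> ?D * (?M - t)\<^sup>2"
    unfolding sum_distrib_right using le d lt
    by (intro sum_mono mult_left_mono power_mono) (auto simp: less_imp_le)
  then have "sqrt (\<Sum>i\<in>UNIV. d i * (max (x i - t) 0)\<^sup>2) \<le> sqrt (?D * (?M - t)\<^sup>2)"
    by (rule real_sqrt_le_mono)
  then have "sqrt (\<Sum>i\<in>UNIV. d i * (max (x i - t) 0)\<^sup>2) \<le> sqrt ?D * (?M - t)"
    using lt by (simp add: real_sqrt_mult)
  then have "sqrt ?D * sqrt (\<Sum>i\<in>UNIV. d i * (max (x i - t) 0)\<^sup>2) \<le> sqrt ?D * (sqrt ?D * (?M - t))"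
    using D by (intro mult_left_mono) auto
  then have den: "sqrt ?D * sqrt (\<Sum>i\<in>UNIV. d i * (max (x i - t) 0)\<^sup>2) \<le> ?D * (?M - t)"
    using D by (simp flip: mult.assoc)
  have "0 < sqrt ?D * sqrt (\<Sum>i\<in>UNIV. d i * (max (x i - t) 0)\<^sup>2)"
    using D sum_relu_sq_pos[of d, OF d lt(2)] by simp
  with num den have "?D * (?a - t) / (?D * (?M - t)) \<le> relu_ratio d x t"
    unfolding relu_ratio_def using D t by (intro frac_le) (auto intro!: sum_nonneg simp: d less_imp_le)
  moreover have "y \<le> (?a - t) / (?M - t)"
    using t(3) lt by (simp add: pos_le_divide_eq algebra_simps)
  ultimately show ?thesis using D t(1) by auto
qed

lemma continuous_on_relu_ratio:
  fixes d x :: "'a::finite \<Rightarrow> real"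
  assumes d: "\<And>i. 0 < d i"
  shows "continuous_on {..<(MAX k. x k)} (relu_ratio d x)"
proof -
  have "sqrt (sum d UNIV) \<noteq> 0" using sum_pos[of UNIV d] d by simp
  moreover have "sqrt (\<Sum>i\<in>UNIV. d i * (max (x i - t) 0)\<^sup>2) \<noteq> 0" if "t < (MAX k. x k)" for t
    using sum_relu_sq_pos[of d, OF d that] by simp
  ultimately show ?thesis
    unfolding relu_ratio_def[abs_def] by (intro continuous_intros) auto
qed

section \<open>From the smoothness on the graph to the quotient\<close>

lemma smoothness_le_1: "smoothness G v \<le> 1"
proof -
  have "norm (top_comp G v) \<le> norm v"
    using Cauchy_Schwarz_ineq2[of v "top_vec G"] by (simp add: top_comp_def norm_top_vec)
  then show ?thesis by (simp add: smoothness_def)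
qed

lemma norm_top_dir: "norm (top_dir G) = sqrt (\<Sum>i\<in>UNIV. aug_deg G $ i $ i)"
  using aug_deg_pos[of G] by (simp add: norm_vec_def L2_set_def top_dir_nth less_imp_le)

lemma norm_top_dir_pos: "0 < norm (top_dir G)"
  unfolding norm_top_dir by (simp add: sum_pos aug_deg_pos)

text \<open>Both z and \<open>top_vec G\<close> carry the factor sqrt d_i in entry i; being
  positive, it passes through the maximum with 0.\<close>

lemma relu_shift_nth:
  fixes z :: "real ^ 'n::finite" and G :: "'n pair_pre_digraph"
  shows "relu (z - \<alpha> *\<^sub>R top_vec G) $ i = sqrt (aug_deg G $ i $ i)
    * max ((diag_powr (aug_deg G) (- 1 / 2) *v z) $ i - \<alpha> / norm (top_dir G)) 0"
proof -
  let ?d = "aug_deg G $ i $ i" and ?x = "(diag_powr (aug_deg G) (- 1 / 2) *v z) $ i"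
  have "z $ i = sqrt ?d * ?x"
    using aug_deg_pos[of G i] by (simp add: diag_powr_nth powr_minus powr_half_sqrt)
  then have "relu (z - \<alpha> *\<^sub>R top_vec G) $ i
      = max (sqrt ?d * (?x - \<alpha> / norm (top_dir G))) (sqrt ?d * 0)"
    by (simp add: relu_def top_vec_def top_dir_nth algebra_simps)
  also have "\<dots> = sqrt ?d * max (?x - \<alpha> / norm (top_dir G)) 0"
    using aug_deg_pos[of G i] by (subst max_mult_distrib_left) auto
  finally show ?thesis .
qed

lemma smoothness_relu_shift:
  fixes z :: "real ^ 'n::finite" and G :: "'n pair_pre_digraph"
  defines "x \<equiv> diag_powr (aug_deg G) (- 1 / 2) *v z"
  shows "smoothness G (relu (z - \<alpha> *\<^sub>R top_vec G)) =
    (if \<alpha> < norm (top_dir G) * (MAX k. x $ k)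
     then relu_ratio (\<lambda>i. aug_deg G $ i $ i) (($) x) (\<alpha> / norm (top_dir G)) else 1)"
proof -
  let ?N = "norm (top_dir G)" and ?d = "\<lambda>i. aug_deg G $ i $ i"
  let ?h = "relu (z - \<alpha> *\<^sub>R top_vec G)" and ?w = "\<lambda>i. max (x $ i - \<alpha> / ?N) 0"
  have h: "?h $ i = sqrt (?d i) * ?w i" for i unfolding x_def by (rule relu_shift_nth)
  have N: "0 < ?N" by (rule norm_top_dir_pos)
  have iff: "\<alpha> < ?N * (MAX k. x $ k) \<longleftrightarrow> \<alpha> / ?N < (MAX k. x $ k)"
    using N by (simp add: pos_divide_less_eq mult.commute)
  show ?thesis
  proof (cases "\<alpha> / ?N < (MAX k. x $ k)")
    case True
    have nh: "norm ?h = sqrt (\<Sum>i\<in>UNIV. ?d i * (?w i)\<^sup>2)"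
      using aug_deg_pos[of G] by (simp add: norm_vec_def L2_set_def h power_mult_distrib less_imp_le)
    then have "norm ?h > 0" using sum_relu_sq_pos[of ?d, OF aug_deg_pos True] by simp
    then have "?h \<noteq> 0" by auto
    have e: "top_vec G $ i = sqrt (?d i) / ?N" for i by (simp add: top_vec_def top_dir_nth)
    have "?h \<bullet> top_vec G = (\<Sum>i\<in>UNIV. ?d i * ?w i) / ?N"
      unfolding inner_vec_def sum_divide_distrib
    proof (intro sum.cong refl)
      fix i
      have "?h $ i * top_vec G $ i = sqrt (?d i) * sqrt (?d i) * ?w i / ?N"
        by (simp only: h e times_divide_eq_right ac_simps)
      also have "sqrt (?d i) * sqrt (?d i) = ?d i" using aug_deg_pos[of G i] by simp
      finally show "?h $ i \<bullet> top_vec G $ i = ?d i * ?w i / ?N" by simp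
    qed
    \<comment> \<open>Removes the absolute value that the norm of the projection introduces.\<close>
    moreover have "0 \<le> (\<Sum>i\<in>UNIV. ?d i * ?w i)"
      by (auto intro!: sum_nonneg mult_nonneg_nonneg simp: aug_deg_pos less_imp_le)
    ultimately have "norm (top_comp G ?h) = (\<Sum>i\<in>UNIV. ?d i * ?w i) / ?N"
      by (simp add: top_comp_def norm_top_vec)
    then show ?thesis using True \<open>?h \<noteq> 0\<close> unfolding iff
      by (simp add: smoothness_def nh relu_ratio_def norm_top_dir)
  next
    case False
    \<comment> \<open>No entry is active, so the value 1 comes from the convention for the zero
      vector.\<close>
    have "x $ i \<le> (MAX k. x $ k)" for i by simp
    then have "x $ i \<le> \<alpha> / ?N" for i using False by (meson not_less order_trans)
    then have "?h = 0" by (simp add: vec_eq_iff h)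
    then show ?thesis using False unfolding iff by (simp add: smoothness_def)
  qed
qed

section \<open>Minimum, maximum, monotonicity and range of the smoothness\<close>

theorem proposition4p3:
  fixes G :: "'n::finite pair_pre_digraph" and z x :: "real ^ 'n"
    and d :: "'n \<Rightarrow> real" and h :: "real \<Rightarrow> real ^ 'n" and m :: real
  assumes graph: "pair_pseudo_graph G" and nodes: "pverts G = UNIV"
    and connected: "Digraph_Component.connected (with_proj G)"
    and z: "perp_comp G z \<noteq> 0"
  defines "h \<equiv> (\<lambda>\<alpha>. relu (z - \<alpha> *\<^sub>R top_vec G))"
    and "x \<equiv> diag_powr (aug_deg G) (- 1 / 2) *v z"
    and "d \<equiv> (\<lambda>i. aug_deg G $ i $ i)"
    and "m \<equiv> sqrt ((\<Sum>i\<in>{i. x $ i = (MAX k. x $ k)}. d i) / (\<Sum>j\<in>UNIV. d j))"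
  shows "(\<exists>\<alpha>. smoothness G (h \<alpha>) = m) \<and> (\<forall>\<alpha>. m \<le> smoothness G (h \<alpha>))
    \<and> (\<exists>\<alpha>. smoothness G (h \<alpha>) = 1) \<and> (\<forall>\<alpha>. smoothness G (h \<alpha>) \<le> 1)
    \<and> antimono_on {..< norm (top_dir G) * (MAX k. x $ k)}
        (\<lambda>\<alpha>. smoothness G (h \<alpha>))
    \<and> range (\<lambda>\<alpha>. smoothness G (h \<alpha>)) = {m..1}"
proof -
  let ?N = "norm (top_dir G)" and ?M = "MAX k. x $ k" and ?s = "\<lambda>\<alpha>. smoothness G (h \<alpha>)"
  let ?r = "relu_ratio d (($) x)"
  have d: "0 < d i" for i by (simp add: d_def aug_deg_pos)
  have N: "0 < ?N" by (rule norm_top_dir_pos)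
  have s: "?s \<alpha> = (if \<alpha> < ?N * ?M then ?r (\<alpha> / ?N) else 1)" for \<alpha>
    unfolding h_def x_def d_def by (rule smoothness_relu_shift)
  have s_mult: "?s (?N * t) = ?r t" if "t < ?M" for t using that N by (simp add: s)
  have s_le: "?s \<alpha> \<le> 1" for \<alpha> by (rule smoothness_le_1)
  \<comment> \<open>At this threshold h vanishes and the smoothness jumps from m to 1, which is why
    the monotonicity is confined to smaller \<alpha>.\<close>
  have s_1: "?s (?N * ?M) = 1" by (simp add: s)
  obtain b where b: "b < ?M" and near: "\<And>t. \<lbrakk>b \<le> t; t < ?M\<rbrakk> \<Longrightarrow> ?r t = m"
    using relu_ratio_near_Max[of d "($) x", OF d] unfolding m_def by blast
  have s_m: "?s (?N * b) = m" using s_mult[OF b] near[OF order_refl b] by simp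
  have m: "0 \<le> m" "m \<le> 1"
    using s_le[of "?N * b"] s_m by (auto simp: m_def d less_imp_le intro!: sum_nonneg divide_nonneg_nonneg)
  have ge: "m \<le> ?s \<alpha>" for \<alpha>
  proof (cases "\<alpha> < ?N * ?M")
    case True
    then have lt: "\<alpha> / ?N < ?M" using N by (simp add: pos_divide_less_eq mult.commute)
    \<comment> \<open>Moving right to b, if necessary, reaches the interval where the quotient is m
      and by antitonicity does not increase it.\<close>
    have "m = ?r (max b (\<alpha> / ?N))" using near[of "max b (\<alpha> / ?N)"] b lt by simp
    also have "\<dots> \<le> ?r (\<alpha> / ?N)" using b lt by (intro relu_ratio_antimono d) auto
    finally show ?thesis using True by (simp add: s)
  qed (simp add: s m)
  have anti: "antimono_on {..< ?N * ?M} ?s"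
  proof (rule monotone_onI)
    fix \<alpha> \<beta> assume A: "\<alpha> \<in> {..< ?N * ?M}" "\<beta> \<in> {..< ?N * ?M}" "\<alpha> \<le> \<beta>"
    then have "\<beta> / ?N < ?M" using N by (simp add: pos_divide_less_eq mult.commute)
    moreover have "\<alpha> / ?N \<le> \<beta> / ?N" using A N by (simp add: divide_right_mono)
    ultimately show "?s \<beta> \<le> ?s \<alpha>" using A by (simp add: s relu_ratio_antimono d)
  qed
  \<comment> \<open>The value 1 is taken by the zero vector. A smaller y lies between the value m at
    b and a value at some a < b that is at least y, so the intermediate value theorem on
    \<open>{a..b}\<close> applies.\<close>
  have "y \<in> range ?s" if y: "m \<le> y" "y \<le> 1" for y
  proof (cases "y = 1")
    case True
    then show ?thesis using s_1 by (metis rangeI)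
  next
    case False
    then obtain a where a: "a < b" "y \<le> ?r a"
      using relu_ratio_ge_far[of d y b "($) x", OF d] m y by auto
    have "continuous_on {a..b} ?r"
      using b by (intro continuous_on_subset[OF continuous_on_relu_ratio[OF d]]) auto
    then obtain t where "a \<le> t" "t \<le> b" "?r t = y"
      using IVT2'[of ?r b y a] a y near[OF order_refl b] by auto
    then show ?thesis using s_mult[of t] b by (metis order_le_less_trans rangeI)
  qed
  then have "range ?s = {m..1}" using ge s_le by auto
  then show ?thesis using s_m s_1 ge s_le anti by blast
qed

end
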